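(* Let $(X,\tau,\mathcal{P})$ be a primal topological space. Then the following statements hold: (a) $\tau_{\delta}\subseteq \tau^{\diamond}_R$, where $\tau_{\delta}$ is the family of all $\delta$-open sets of $(X,\tau)$; (b) $\tau^{\diamond}_R\subseteq \tau^{\diamond}$.
   Context: A primal on a nonempty set $X$ is a collection $\mathcal{P}\subseteq 2^X$ such that: $X\notin\mathcal{P}$; if $A\in\mathcal{P}$ and $B\subseteq A$, then $B\in\mathcal{P}$; if $A\cap B\in\mathcal{P}$, then $A\in\mathcal{P}$ or $B\in\mathcal{P}$. (The empty collection is allowed.) A primal topological space $(X,\tau,\mathcal{P})$ is a topological space $(X,\tau)$ with a primal $\mathcal{P}$ on $X$. $A^c$ denotes $X\setminus A$. A set $U\subseteq X$ is regular open if $U=int(cl(U))$. $O(X,x)$ (resp. $RO(X,x)$) is the family of open (resp. regular open) sets containing the point $x$. A set is $\delta$-open if it equals the union of all regular open sets contained in it. For $A\subseteq X$: $A^{\diamond}=\{x\in X : A^c\cup U^c\in\mathcal{P}\text{ for all }U\in O(X,x)\}$, $cl^{\diamond}(A)=A\cup A^{\diamond}$, and $\tau^{\diamond}=\{A\subseteq X: cl^{\diamond}(A^c)=A^c\}$; $A^{\diamond}_R=\{x\in X : A^c\cup U^c\in\mathcal{P}\text{ for all }U\in RO(X,x)\}$, $cl^{\diamond}_R(A)=A\cup A^{\diamond}_R$, and $\tau^{\diamond}_R=\{A\subseteq X: cl^{\diamond}_R(A^c)=A^c\}$. *)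

theory Defs
  imports "HOL-Analysis.Abstract_Topology"
begin

definition primal :: "'a set \<Rightarrow> 'a set set \<Rightarrow> bool" where
  "primal X P \<longleftrightarrow>
     X \<noteq> {} \<and> P \<subseteq> Pow X \<and> X \<notin> P \<and>
     (\<forall>A B. A \<in> P \<and> B \<subseteq> A \<longrightarrow> B \<in> P) \<and>
     (\<forall>A B. A \<subseteq> X \<and> B \<subseteq> X \<and> A \<inter> B \<in> P \<longrightarrow> A \<in> P \<or> B \<in> P)"

definition primal_topological_space :: "'a topology \<Rightarrow> 'a set set \<Rightarrow> bool" where
  "primal_topological_space T P \<longleftrightarrow> primal (topspace T) P"

definition regular_open_in :: "'a topology \<Rightarrow> 'a set \<Rightarrow> bool" where
  "regular_open_in T U \<longleftrightarrow> U \<subseteq> topspace T \<and> U = T interior_of (T closure_of U)"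

definition open_nbhds :: "'a topology \<Rightarrow> 'a \<Rightarrow> 'a set set" where
  "open_nbhds T x = {U. openin T U \<and> x \<in> U}"

definition regular_open_nbhds :: "'a topology \<Rightarrow> 'a \<Rightarrow> 'a set set" where
  "regular_open_nbhds T x = {U. regular_open_in T U \<and> x \<in> U}"

definition delta_open_in :: "'a topology \<Rightarrow> 'a set \<Rightarrow> bool" where
  "delta_open_in T A \<longleftrightarrow> A \<subseteq> topspace T \<and> A = \<Union>{U. regular_open_in T U \<and> U \<subseteq> A}"

definition tau_delta :: "'a topology \<Rightarrow> 'a set set" where
  "tau_delta T = {A. delta_open_in T A}"

(* Complements are taken relative to the carrier topspace T, which need not be
   the whole type. *)

definition diamond :: "'a topology \<Rightarrow> 'a set set \<Rightarrow> 'a set \<Rightarrow> 'a set" where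
  "diamond T P A =
     {x \<in> topspace T. \<forall>U \<in> open_nbhds T x. (topspace T - A) \<union> (topspace T - U) \<in> P}"

definition cl_diamond :: "'a topology \<Rightarrow> 'a set set \<Rightarrow> 'a set \<Rightarrow> 'a set" where
  "cl_diamond T P A = A \<union> diamond T P A"

definition tau_diamond :: "'a topology \<Rightarrow> 'a set set \<Rightarrow> 'a set set" where
  "tau_diamond T P =
     {A. A \<subseteq> topspace T \<and> cl_diamond T P (topspace T - A) = topspace T - A}"

definition diamond_R :: "'a topology \<Rightarrow> 'a set set \<Rightarrow> 'a set \<Rightarrow> 'a set" where
  "diamond_R T P A =
     {x \<in> topspace T. \<forall>U \<in> regular_open_nbhds T x. (topspace T - A) \<union> (topspace T - U) \<in> P}"

definition cl_diamond_R :: "'a topology \<Rightarrow> 'a set set \<Rightarrow> 'a set \<Rightarrow> 'a set" where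
  "cl_diamond_R T P A = A \<union> diamond_R T P A"

definition tau_diamond_R :: "'a topology \<Rightarrow> 'a set set \<Rightarrow> 'a set set" where
  "tau_diamond_R T P =
     {A. A \<subseteq> topspace T \<and> cl_diamond_R T P (topspace T - A) = topspace T - A}"

end

theory Submission
  imports Defs
begin

text \<open>A set belongs to either family exactly when the operator applied to its complement adds
  no new point, so a smaller operator gives a larger family. Regular open sets are open, so
  \<open>diamond\<close> tests at least the neighbourhoods that \<open>diamond_R\<close> tests and
  is the smaller operator (\<open>diamond_subset_diamond_R\<close>); this gives (b). For (a), a
  point x of a \<delta>-open A lies in some regular open U inside A. The set tested for the
  complement of A is then A together with the complement of U, which is the whole space and hence
  not in the primal, so U keeps x out of the operator's value.\<close>

lemma regular_open_in_imp_openin: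
  assumes "regular_open_in T U"
  shows "openin T U"
proof -
  have "U = T interior_of (T closure_of U)"
    using assms unfolding regular_open_in_def by (rule conjunct2)
  moreover have "openin T (T interior_of (T closure_of U))"
    by (rule openin_interior_of)
  \<comment> \<open>\<open>U\<close> occurs on both sides of the equation, so it is used for one
    substitution with a fixed predicate; as a rewrite rule it would loop.\<close>
  ultimately show ?thesis
    by (rule ssubst[where P = "openin T"])
qed

lemma diamond_subset_diamond_R: "diamond T P A \<subseteq> diamond_R T P A"
  by (auto simp: diamond_def diamond_R_def open_nbhds_def regular_open_nbhds_def
      dest: regular_open_in_imp_openin)

text \<open>The fixed-point equation becomes an inclusion, in which a smaller operator can be
  substituted by transitivity.\<close>

lemma tau_diamond_iff:
  "A \<in> tau_diamond T P \<longleftrightarrow>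
     A \<subseteq> topspace T \<and> diamond T P (topspace T - A) \<subseteq> topspace T - A"
  by (simp only: tau_diamond_def cl_diamond_def mem_Collect_eq subset_Un_eq Un_commute)

lemma tau_diamond_R_iff:
  "A \<in> tau_diamond_R T P \<longleftrightarrow>
     A \<subseteq> topspace T \<and> diamond_R T P (topspace T - A) \<subseteq> topspace T - A"
  by (simp only: tau_diamond_R_def cl_diamond_R_def mem_Collect_eq subset_Un_eq Un_commute)

lemma tau_diamond_R_subset_tau_diamond: "tau_diamond_R T P \<subseteq> tau_diamond T P"
  by (meson subsetI tau_diamond_iff tau_diamond_R_iff diamond_subset_diamond_R subset_trans)

lemma tau_delta_subset_tau_diamond_R:
  assumes "topspace T \<notin> P"
  shows "tau_delta T \<subseteq> tau_diamond_R T P"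
proof
  fix A assume "A \<in> tau_delta T"
  then have delta: "A \<subseteq> topspace T \<and> A = \<Union>{U. regular_open_in T U \<and> U \<subseteq> A}"
    unfolding tau_delta_def delta_open_in_def mem_Collect_eq .
  note A = conjunct1[OF delta] and union = conjunct2[OF delta]
  have "x \<notin> diamond_R T P (topspace T - A)" if "x \<in> A" for x
  proof
    assume x: "x \<in> diamond_R T P (topspace T - A)"
    obtain U where U: "regular_open_in T U" "U \<subseteq> A" "x \<in> U"
      using subsetD[OF equalityD1[OF union] \<open>x \<in> A\<close>] by (elim UnionE CollectE conjE)
    then have "U \<in> regular_open_nbhds T x"
      by (simp add: regular_open_nbhds_def)
    with x have "(topspace T - (topspace T - A)) \<union> (topspace T - U) \<in> P"
      by (simp add: diamond_R_def)
    \<comment> \<open>The double complement is \<open>A\<close>, and the complement of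
      \<open>U\<close> covers everything outside \<open>A\<close> because \<open>U\<close> lies in
      \<open>A\<close>.\<close>
    moreover have "(topspace T - (topspace T - A)) \<union> (topspace T - U) = topspace T"
      using A U(2) by blast
    ultimately show False
      using assms by simp
  qed
  moreover have "diamond_R T P (topspace T - A) \<subseteq> topspace T"
    by (simp add: diamond_R_def)
  ultimately have "diamond_R T P (topspace T - A) \<subseteq> topspace T - A"
    by (meson DiffI subsetD subsetI)
  then show "A \<in> tau_diamond_R T P"
    using A by (simp add: tau_diamond_R_iff)
qed

theorem theorem4p2:
  fixes T :: "'a topology" and P :: "'a set set"
  assumes "primal_topological_space T P"
  shows "tau_delta T \<subseteq> tau_diamond_R T P \<and> tau_diamond_R T P \<subseteq> tau_diamond T P"
proof -
  have "topspace T \<notin> P"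
    using assms by (simp add: primal_topological_space_def primal_def)
  then show ?thesis
    by (intro conjI tau_delta_subset_tau_diamond_R tau_diamond_R_subset_tau_diamond)
qed

end
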